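(* If $E(\lambda)$ is a $\top$-odd $n\times n$ matrix pencil with $\operatorname{rank}E=r\leq n$, then it can be written as $$E(\lambda)=\begin{cases}v_1w_1(\lambda)^\top+\cdots+v_sw_s(\lambda)^\top-w_1(-\lambda)v_1^\top-\cdots-w_s(-\lambda)v_s^\top,&\text{if } r \text{ is even},\\ \lambda uu^\top+v_1w_1(\lambda)^\top+\cdots+v_sw_s(\lambda)^\top-w_1(-\lambda)v_1^\top-\cdots-w_s(-\lambda)v_s^\top,&\text{if } r \text{ is odd},\end{cases}$$ where $u,v_j,w_j\in\mathbb C[\lambda]^n$, $s=\lfloor r/2\rfloor$, $\deg u=\deg v_1=\cdots=\deg v_s=0$ and $\deg w_1,\dots,\deg w_s\leq 1$.
   Context: A matrix pencil $E(\lambda)=A+\lambda B$ with $A,B\in\mathbb C^{n\times n}$ is $\top$-odd if $A^\top=-A$ and $B^\top=B$. Its rank is the normal rank, i.e. the rank as a matrix over the field of rational functions, $\max_{\lambda\in\mathbb C}\operatorname{rank}(A+\lambda B)$. For $v(\lambda)\in\mathbb C[\lambda]^n$, $\deg v$ is the largest degree of the entries of $v$; so $\deg v=0$ means that $v$ is a constant vector in $\mathbb C^n$. *)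

theory Defs
  imports "HOL-Analysis.Analysis" "HOL-Computational_Algebra.Computational_Algebra"
begin

definition pencil :: "complex^'n^'n \<Rightarrow> complex^'n^'n \<Rightarrow> complex poly^'n^'n" where
  "pencil A B = (\<chi> i j. [:A $ i $ j, B $ i $ j:])"

definition top_odd :: "complex poly^'n^'n \<Rightarrow> bool" where
  "top_odd E \<longleftrightarrow> (\<exists>A B. E = pencil A B \<and> transpose A = - A \<and> transpose B = B)"

text \<open>Rank over the field of rational functions, i.e. the fraction field of \<open>\<complex>[\<lambda>]\<close>.\<close>

definition normal_rank :: "complex poly^'n^'m \<Rightarrow> nat" where
  "normal_rank E = rank (map_matrix to_fract E)"

text \<open>The zero vector has degree 0, so the vectors of degree 0 are exactly the constant ones.\<close>

definition vec_degree :: "complex poly^'n \<Rightarrow> nat" where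
  "vec_degree v = Max (range (\<lambda>i. degree (v $ i)))"

text \<open>\<open>vec_reflect w\<close> is \<open>w(-\<lambda>)\<close>.\<close>

definition vec_reflect :: "complex poly^'n \<Rightarrow> complex poly^'n" where
  "vec_reflect w = (\<chi> i. pcompose (w $ i) [:0, -1:])"

definition outer_prod :: "complex poly^'m \<Rightarrow> complex poly^'n \<Rightarrow> complex poly^'n^'m" where
  "outer_prod v w = (\<chi> i j. v $ i * w $ j)"

end

theory Submission
  imports Defs
begin

text \<open>Evaluate the pencil \<open>A + \<lambda>B\<close> on pairs of vectors: \<open>A\<close> gives an alternating bilinear form
\<open>a\<close> and \<open>B\<close> a symmetric one \<open>b\<close>. Suppose \<open>W\<close> is a subspace of dimension at least \<open>n - s\<close>.
Projecting along \<open>W\<close> splits off from \<open>a + \<lambda>b\<close> a part of the form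
\<open>\<Sum>\<^sub>j v\<^sub>j w\<^sub>j(\<lambda>)\<^sup>T - w\<^sub>j(-\<lambda>) v\<^sub>j\<^sup>T\<close> with \<open>s\<close> constant vectors \<open>v\<^sub>j\<close>, and what remains is the restriction of the
pencil to \<open>W\<close> (\<open>projection_along_subspace\<close>, \<open>form_split\<close>). So it is enough to find \<open>W\<close> such that
\<open>a\<close> vanishes on \<open>W\<close> and \<open>b\<close> vanishes on \<open>W\<close> (\<open>r\<close> even) or is the square of a functional on \<open>W\<close>
(\<open>r\<close> odd).

Such a \<open>W\<close> is built one vector at a time (\<open>ex_common_isotropic_subspace\<close>), without any canonical
form of the pencil. The key is that in dimension at least 2 there is always a nonzero \<open>x\<close> with
\<open>b(x, x) = 0\<close> for which the functionals \<open>a(x, _)\<close> and \<open>b(x, _)\<close> are linearly dependent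
(\<open>ex_isotropic_eigenvector\<close>). The vectors orthogonal to \<open>x\<close> for both forms then make up a
subspace of codimension at most 1, and it contains \<open>x\<close>. A complement of \<open>x\<close> in it carries a
smaller odd pencil, and \<open>x\<close> together with a solution there is a solution here. If the
codimension is 1, two dimensions are lost and the rank drops by 2; if it is 0, one dimension is lost
and the rank stays. Either way the count \<open>dim W \<ge> n - r div 2\<close> survives.

The normal rank enters only through the kernels of the evaluated matrices: for all but finitely
many \<open>\<lambda>\<close> the kernel of \<open>A + \<lambda>B\<close> has dimension at least \<open>n - r\<close>
(\<open>dim_kernel_at_generic_point\<close>).\<close>

section \<open>Hyperplanes, complements and eigenvectors in subspaces\<close>

lemma dim_le_dim_hyperplane:
  fixes h :: "'a::field^'n \<Rightarrow> 'a" and U :: "('a^'n) set"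
  assumes U: "vec.subspace U"
    and add: "\<And>x y. h (x + y) = h x + h y" and scale: "\<And>c x. h (c *s x) = c * h x"
  shows "vec.subspace {z \<in> U. h z = 0}" and "vec.dim U \<le> vec.dim {z \<in> U. h z = 0} + 1"
proof -
  let ?K = "{z \<in> U. h z = 0}"
  have h0: "h 0 = 0" using scale[of 0 0] by simp
  have diff: "h (x - y) = h x - h y" for x y
    using add[of x "(-1) *s y"] scale[of "-1" y] by simp
  show K: "vec.subspace ?K"
    using U by (auto simp: vec.subspace_def h0 add scale)
  show "vec.dim U \<le> vec.dim ?K + 1"
  proof (cases "\<exists>t\<in>U. h t \<noteq> 0")
    case True
    then obtain t where t: "t \<in> U" "h t \<noteq> 0" by blast
    have "U \<subseteq> vec.span (insert t ?K)"
    proof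
      fix y assume y: "y \<in> U"
      have "y - (h y / h t) *s t \<in> ?K"
        using y t U by (simp add: diff scale vec.subspace_diff vec.subspace_scale)
      then show "y \<in> vec.span (insert t ?K)"
        unfolding vec.span_breakdown_eq by (intro exI vec.span_base)
    qed
    then have "vec.dim U \<le> vec.dim (insert t ?K)" by (rule vec.subset_le_dim)
    also have "\<dots> \<le> vec.dim ?K + 1" by (simp add: vec.dim_insert)
    finally show ?thesis .
  next
    case False
    then have "?K = U" by blast
    then show ?thesis by simp
  qed
qed

text \<open>The complement of a line stands in for the quotient by it, so that an induction on dimension can
stay inside one coordinate space.\<close>

lemma complement_of_vector:
  fixes U :: "('a::field^'n) set"
  assumes U: "vec.subspace U" and x: "x \<in> U" "x \<noteq> 0"
  obtains U' where "vec.subspace U'" "U' \<subseteq> U" "x \<notin> U'" "vec.dim U = vec.dim U' + 1"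
    "\<And>y. y \<in> U \<Longrightarrow> \<exists>k. y - k *s x \<in> U'"
proof -
  have "vec.independent {x}" using x by simp
  then obtain B where B: "{x} \<subseteq> B" "B \<subseteq> U" "vec.independent B" "U \<subseteq> vec.span B"
    using vec.maximal_independent_subset_extend[of "{x}" U] x by blast
  let ?U' = "vec.span (B - {x})"
  have BU: "vec.span B = U" using B U by (metis vec.span_subspace)
  have ins: "B = insert x (B - {x})" using B by blast
  have nx: "x \<notin> ?U'" using B(1,3) unfolding vec.dependent_def by blast
  show thesis
  proof (rule that[of ?U'])
    show "vec.subspace ?U'" by (rule vec.subspace_span)
    show "?U' \<subseteq> U" using BU vec.span_mono[of "B - {x}" B] by blast
    show "x \<notin> ?U'" by (rule nx)
    have "vec.dim U = vec.dim (insert x (B - {x}))" using BU ins by (metis vec.dim_span)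
    then show "vec.dim U = vec.dim ?U' + 1"
      using nx by (simp only: vec.dim_insert vec.dim_span if_False)
    show "\<exists>k. y - k *s x \<in> ?U'" if "y \<in> U" for y
      using that BU ins by (metis vec.span_breakdown_eq)
  qed
qed

text \<open>Among the nonzero polynomials \<open>p\<close> with \<open>p(N) v = 0\<close> take one of least degree and split off a root
\<open>\<mu>\<close>, say \<open>p = (X - \<mu>) q\<close>. Then \<open>q(N) v\<close> is nonzero and is an eigenvector for \<open>\<mu>\<close>.\<close>

lemma eigenvector_in_invariant_subspace:
  fixes N :: "complex^'n \<Rightarrow> complex^'n"
  assumes N: "Vector_Spaces.linear (*s) (*s) N" and I: "vec.subspace I"
    and v: "v \<in> I" "v \<noteq> 0" and inv: "\<And>x. x \<in> I \<Longrightarrow> N x \<in> I"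
  obtains x \<mu> where "x \<in> I" "x \<noteq> 0" "N x = \<mu> *s x"
proof -
  interpret N: Vector_Spaces.linear "(*s)" "(*s)" N by (rule N)
  \<comment> \<open>\<open>ev p = p(N) v\<close>, evaluated by Horner's scheme\<close>
  define ev where "ev p = fold_coeffs (\<lambda>c w. c *s v + N w) p 0" for p
  have ev0: "ev 0 = 0" by (simp add: ev_def)
  have ev_pCons: "ev (pCons c q) = c *s v + N (ev q)" for c q
    by (cases "c = 0 \<and> q = 0") (auto simp: ev_def N.zero)
  have ev_add: "ev (p + q) = ev p + ev q" for p q
    by (induction p q rule: poly_induct2)
       (auto simp: ev0 ev_pCons N.add vec.scale_left_distrib)
  have ev_smult: "ev (smult c p) = c *s ev p" for c p
    by (induction p)
       (auto simp: ev0 ev_pCons N.scale vec.scale_right_distrib)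
  have ev_sum: "ev (\<Sum>i\<in>A. g i) = (\<Sum>i\<in>A. ev (g i))" for g and A :: "nat set"
    by (induction A rule: infinite_finite_induct) (auto simp: ev0 ev_add)
  have ev_I: "ev p \<in> I" for p
    by (induction p) (auto simp: ev0 ev_pCons I vec.subspace_0 vec.subspace_add vec.subspace_scale v inv)
  \<comment> \<open>The \<open>n + 1\<close> vectors \<open>v, N v, \<dots>, N\<^sup>n v\<close> are dependent.\<close>
  have ex: "\<exists>p. p \<noteq> 0 \<and> ev p = 0"
  proof (rule ccontr)
    assume contra: "\<not> ?thesis"
    let ?m = "\<lambda>i. ev (monom 1 i)"
    have inj: "inj_on ?m {..CARD('n)}"
    proof (rule inj_onI)
      fix i j assume "?m i = ?m j"
      then have "ev (monom 1 i + smult (-1) (monom 1 j)) = 0"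
        by (simp only: ev_add ev_smult) simp
      then have "monom 1 i + smult (-1) (monom 1 j) = (0::complex poly)" using contra by blast
      then show "i = j" by (metis coeff_add coeff_monom coeff_smult coeff_0 add.right_neutral mult_zero_right zero_neq_one)
    qed
    have "vec.independent (?m ` {..CARD('n)})"
    proof (rule vec.independent_if_scalars_zero)
      fix f y assume s: "(\<Sum>x\<in>?m ` {..CARD('n)}. f x *s x) = 0" and y: "y \<in> ?m ` {..CARD('n)}"
      then obtain k where k: "k \<le> CARD('n)" "y = ?m k" by blast
      let ?p = "\<Sum>i\<le>CARD('n). smult (f (?m i)) (monom 1 i)"
      have "ev ?p = 0" using s by (simp add: ev_sum ev_smult sum.reindex[OF inj])
      then have "?p = 0" using contra by blast
      then have "coeff ?p k = 0" by simp
      then show "f y = 0" using k by (simp add: coeff_sum if_distrib sum.delta cong: if_cong)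
    qed simp
    then have "card (?m ` {..CARD('n)}) \<le> vec.dim (UNIV :: (complex^'n) set)"
      by (rule vec.independent_card_le_dim[OF subset_UNIV])
    then show False by (simp add: card_image[OF inj] vec_dim_card del: vec.dim_UNIV)
  qed
  define P where "P p \<longleftrightarrow> p \<noteq> 0 \<and> ev p = 0" for p
  obtain p where p: "P p" and min: "\<And>q. P q \<Longrightarrow> degree p \<le> degree q"
    using ex exists_least_iff[of "\<lambda>d. \<exists>p. P p \<and> degree p = d"] unfolding P_def
    by (metis (no_types, lifting) linorder_not_le)
  have "degree p \<noteq> 0"
  proof
    assume "degree p = 0"
    then obtain c where c: "p = [:c:]" by (metis degree_eq_zeroE)
    then show False using p v by (simp add: P_def ev_pCons ev0 N.zero)
  qed
  then obtain \<mu> where "poly p \<mu> = 0"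
    using fundamental_theorem_of_algebra[of p] constant_degree[of p] by auto
  then obtain q where q: "p = [:-\<mu>, 1:] * q" by (metis dvdE poly_eq_0_iff_dvd)
  have q0: "q \<noteq> 0" using p q by (auto simp: P_def)
  have "degree p = Suc (degree q)"
    unfolding q using q0 by (subst degree_mult_eq) (auto simp del: mult_pCons_left)
  then have nz: "ev q \<noteq> 0" using min[of q] q0 by (auto simp: P_def)
  have "p = smult (-\<mu>) q + pCons 0 q" using q by simp
  then have "ev p = (-\<mu>) *s ev q + N (ev q)" by (simp only: ev_add ev_smult ev_pCons) simp
  then have "N (ev q) = \<mu> *s ev q" using p by (simp add: P_def)
  with that[OF ev_I nz] show thesis by blast
qed

section \<open>An alternating and a symmetric form\<close>

locale odd_forms =
  fixes a b :: "complex^'n \<Rightarrow> complex^'n \<Rightarrow> complex"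
  assumes a_add: "a x (y + z) = a x y + a x z" and a_scale: "a x (c *s y) = c * a x y"
    and a_skew: "a x y = - a y x"
    and b_add: "b x (y + z) = b x y + b x z" and b_scale: "b x (c *s y) = c * b x y"
    and b_sym: "b x y = b y x"
begin

lemma add_left: "a (x + y) z = a x z + a y z" "b (x + y) z = b x z + b y z"
  using a_add[of z x y] b_add[of z x y] a_skew[of "x + y" z] a_skew[of x z] a_skew[of y z]
    b_sym[of "x + y" z] b_sym[of x z] b_sym[of y z] by simp_all

lemma scale_left: "a (c *s x) z = c * a x z" "b (c *s x) z = c * b x z"
  using a_scale[of z c x] b_scale[of z c x] a_skew[of "c *s x" z] a_skew[of x z]
    b_sym[of "c *s x" z] b_sym[of x z] by simp_all

lemmas bilin = a_add a_scale b_add b_scale add_left scale_left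

lemma zero_form [simp]: "a x 0 = 0" "b x 0 = 0" "a 0 x = 0" "b 0 x = 0"
  using a_scale[of x 0 0] b_scale[of x 0 0] scale_left[of 0 0 x] by simp_all

lemma a_self [simp]: "a x x = 0"
  using a_skew[of x x] unfolding eq_neg_iff_add_eq_0 mult_2[symmetric] by simp

lemma uminus_form: "a x (- y) = - a x y" "b x (- y) = - b x y" "a (- x) y = - a x y" "b (- x) y = - b x y"
  using bilin(2,4,6,8)[of _ "-1"] bilin(7,8)[of "-1"] by simp_all

lemma diff_form: "a x (y - z) = a x y - a x z" "b x (y - z) = b x y - b x z"
  "a (x - y) z = a x z - a y z" "b (x - y) z = b x z - b y z"
  using bilin(1,3)[of x y "- z"] add_left[of x "- y" z] by (simp_all add: uminus_form)

text \<open>On the line \<open>x + t y\<close> through independent \<open>x\<close> and \<open>y\<close> the value \<open>b(x + t y, x + t y)\<close> is a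
polynomial in \<open>t\<close> with leading coefficient \<open>b(y, y)\<close>, so it has a root unless \<open>y\<close> is isotropic
itself, and then \<open>y\<close> serves.\<close>

lemma ex_isotropic_vector:
  assumes U: "vec.subspace U" and dim: "2 \<le> vec.dim U"
  obtains x where "x \<in> U" "x \<noteq> 0" "b x x = 0"
proof -
  obtain y where y: "y \<in> U" "y \<noteq> 0"
    using dim by (metis vec.dim_eq_0 not_numeral_le_zero singletonI subsetI)
  obtain U' where U': "vec.subspace U'" "U' \<subseteq> U" "y \<notin> U'" "vec.dim U = vec.dim U' + 1"
    using complement_of_vector[OF U y] by metis
  obtain x where x: "x \<in> U'" "x \<noteq> 0"
    using dim U'(4) by (metis vec.dim_eq_0 Suc_1 Suc_eq_plus1 add_0 not_less_eq_eq le_refl singletonI subsetI)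
  show thesis
  proof (cases "b y y = 0")
    case True
    then show thesis using that y by blast
  next
    case False
    have "\<not> constant (poly [:b x x, 2 * b x y, b y y:])"
      using False by (simp add: constant_degree)
    then obtain t where t: "poly [:b x x, 2 * b x y, b y y:] t = 0"
      using fundamental_theorem_of_algebra by blast
    have "b (x + t *s y) (x + t *s y) = 0"
      using t by (simp add: bilin b_sym[of y x] algebra_simps)
    moreover have "x + t *s y \<noteq> 0"
    proof
      assume eq: "x + t *s y = 0"
      have "t \<noteq> 0" using eq x by auto
      have "t *s y = - x" using eq by (metis add_eq_0_iff)
      then have "inverse t *s (t *s y) \<in> U'"
        using U'(1) x(1) by (simp add: vec.subspace_neg vec.subspace_scale)
      then show False using \<open>t \<noteq> 0\<close> U'(3) by simp
    qed
    ultimately show thesis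
      using that[of "x + t *s y"] x y U U'(2) by (meson subsetD vec.subspace_add vec.subspace_scale)
  qed
qed

text \<open>A vector in the radical of \<open>b\<close> will do. If \<open>b\<close> is nondegenerate on \<open>U\<close>, then \<open>a(x, z) = b(N x, z)\<close>
for an endomorphism \<open>N\<close> of \<open>U\<close>, and an eigenvector \<open>x\<close> of \<open>N\<close> with eigenvalue \<open>\<mu>\<close> satisfies
\<open>a(x, _) = \<mu> b(x, _)\<close>. For \<open>\<mu> \<noteq> 0\<close> it is isotropic because \<open>a(x, x) = 0\<close>. To cover \<open>\<mu> = 0\<close>
the eigenvector is chosen in the image of \<open>N\<close>: if \<open>x = N z\<close> then
\<open>b(x, x) = a(z, x) = - a(x, z) = 0\<close>. When the image is zero, \<open>a\<close> vanishes on \<open>U\<close> and any isotropic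
vector of \<open>b\<close> serves.\<close>

lemma ex_isotropic_eigenvector:
  assumes U: "vec.subspace U" and dim: "2 \<le> vec.dim U"
  obtains x c d where "x \<in> U" "x \<noteq> 0" "b x x = 0" "c \<noteq> 0 \<or> d \<noteq> 0"
    "\<And>z. z \<in> U \<Longrightarrow> d * a x z = c * b x z"
proof (cases "\<exists>x\<in>U. x \<noteq> 0 \<and> (\<forall>z\<in>U. b x z = 0)")
  case True
  then obtain x where x: "x \<in> U" "x \<noteq> 0" "\<forall>z\<in>U. b x z = 0" by blast
  show thesis by (rule that[of x 1 0]) (use x in auto)
next
  case False
  then have nondeg: "x = 0" if "x \<in> U" "\<And>z. z \<in> U \<Longrightarrow> b x z = 0" for x
    using that by blast
  obtain S where S: "finite S" "S \<subseteq> U" "vec.independent S" "vec.span S = U"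
    using vec.basis_subspace_exists[OF U] by metis
  \<comment> \<open>\<open>T f x\<close> encodes the functional \<open>f x\<close> on \<open>U\<close> as a vector of \<open>U\<close>, through its values on the
    basis \<open>S\<close>. Hence \<open>N\<close> is \<open>T a\<close> followed by the inverse of \<open>T b\<close> on \<open>U\<close>.\<close>
  define T where "T f x = (\<Sum>e\<in>S. f x e *s e)" for f :: "complex^'n \<Rightarrow> complex^'n \<Rightarrow> complex" and x
  have TU: "T f x \<in> U" for f x
    unfolding T_def using S(2) by (intro vec.subspace_sum U vec.subspace_scale) auto
  have T_cong: "f x e = g y e" if "T f x = T g y" "e \<in> S" for f g x y e
  proof -
    have "(\<Sum>e\<in>S. (f x e - g y e) *s e) = 0"
      using that(1) by (simp add: T_def vec.scale_left_diff_distrib sum_subtractf)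
    then show ?thesis using S(3) that(2) unfolding vec.independent_explicit by (metis eq_iff_diff_eq_0)
  qed
  have lin: "Vector_Spaces.linear (*s) (*s) (T a)" "Vector_Spaces.linear (*s) (*s) (T b)"
    by (unfold_locales;
        simp add: T_def bilin vec.scale_left_distrib sum.distrib vec.scale_sum_right)+
  have extend: "f x = g x" if "\<And>e. e \<in> S \<Longrightarrow> f e = g e" "x \<in> U"
      "\<And>x y. f (x + y) = f x + f y" "\<And>c x. f (c *s x) = c * f x"
      "\<And>x y. g (x + y) = g x + g y" "\<And>c x. g (c *s x) = c * g x" for f g :: "complex^'n \<Rightarrow> complex" and x
  proof -
    have "x \<in> vec.span S" using that(2) S by simp
    then show ?thesis
      by (induction rule: vec.span_induct_alt)
         (use that(1,3-) that(4)[of 0 0] that(6)[of 0 0] in auto)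
  qed
  interpret Tb: Vector_Spaces.linear "(*s)" "(*s)" "T b" by (rule lin)
  have inj: "inj_on (T b) U"
  proof (rule inj_onI)
    fix x y assume xy: "x \<in> U" "y \<in> U" "T b x = T b y"
    have "b (x - y) z = 0" if "z \<in> U" for z
    proof -
      have "b x z = b y z"
        by (rule extend[OF T_cong[of b x b y] that]) (use xy in \<open>auto simp: bilin\<close>)
      then show ?thesis by (simp add: diff_form)
    qed
    then show "x = y" using nondeg[of "x - y"] xy U by (simp add: vec.subspace_diff)
  qed
  have onto: "T b ` U = U"
  proof (rule vec.subspace_dim_equal)
    show "vec.subspace (T b ` U)" using U by (rule Tb.subspace_image)
    have "vec.dim (T b ` U) = vec.dim U"
      by (rule vec.dim_image_eq[OF lin(2)]) (use inj U in \<open>simp add: vec.span_eq_iff[THEN iffD2]\<close>)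
    then show "vec.dim (T b ` U) \<ge> vec.dim U" by simp
  qed (use U TU in auto)
  obtain g where g: "range g \<subseteq> U" "Vector_Spaces.linear (*s) (*s) g" "\<And>x. x \<in> U \<Longrightarrow> g (T b x) = x"
    using vec.linear_exists_left_inverse_on[OF lin(2) U inj] by blast
  have Tg: "T b (g y) = y" if "y \<in> U" for y
    using that onto g(3) by (metis imageE)
  define N where "N = g \<circ> T a"
  have N_lin: "Vector_Spaces.linear (*s) (*s) N"
    unfolding N_def by (rule Vector_Spaces.linear_compose[OF lin(1) g(2)])
  interpret N: Vector_Spaces.linear "(*s)" "(*s)" N by (rule N_lin)
  have NU: "N x \<in> U" for x using g(1) by (auto simp: N_def)
  have bN: "b (N x) z = a x z" if "z \<in> U" for x z
    by (rule extend[OF T_cong[of b "N x" a x] that])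
       (use Tg TU in \<open>auto simp: bilin N_def\<close>)
  show thesis
  proof (cases "\<exists>x\<in>U. N x \<noteq> 0")
    case True
    then obtain v where v: "v \<in> U" "N v \<noteq> 0" by blast
    obtain x \<mu> where x: "x \<in> N ` U" "x \<noteq> 0" "N x = \<mu> *s x"
      by (rule eigenvector_in_invariant_subspace[OF N_lin, of "N ` U" "N v"])
         (use v U NU N.subspace_image in auto)
    then obtain z where z: "z \<in> U" "x = N z" by blast
    have xU: "x \<in> U" using z NU by simp
    have ax: "a x y = \<mu> * b x y" if "y \<in> U" for y
      using bN[OF that, of x] x(3) by (simp add: bilin)
    have "b x x = 0"
    proof (cases "\<mu> = 0")
      case True
      have "b x x = a z x" using bN[OF xU, of z] z by simp
      also have "\<dots> = 0" using a_skew[of z x] ax[OF z(1)] True by simp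
      finally show ?thesis .
    next
      case False
      then show ?thesis using ax[OF xU] by simp
    qed
    then show thesis by (intro that[of x \<mu> 1]) (use x xU ax in auto)
  next
    case False
    then have a0: "a x z = 0" if "x \<in> U" "z \<in> U" for x z
      using that bN[of z x] by simp
    obtain x where "x \<in> U" "x \<noteq> 0" "b x x = 0"
      by (rule ex_isotropic_vector[OF U dim])
    then show thesis by (intro that[of x 0 1]) (use a0 in auto)
  qed
qed

section \<open>A large common isotropic subspace\<close>

text \<open>The rank of the form \<open>a + l b\<close> on \<open>U\<close> is measured by the codimension of this radical in \<open>U\<close>.\<close>
definition radical :: "complex \<Rightarrow> (complex^'n) set \<Rightarrow> (complex^'n) set" where
  "radical l U = {y \<in> U. \<forall>z\<in>U. a z y + l * b z y = 0}"

lemma subspace_radical: "vec.subspace U \<Longrightarrow> vec.subspace (radical l U)"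
proof -
  assume U: "vec.subspace U"
  have "a z (x + y) + l * b z (x + y) = (a z x + l * b z x) + (a z y + l * b z y)"
    "a z (c *s x) + l * b z (c *s x) = c * (a z x + l * b z x)" for x y z c
    by (simp_all add: bilin algebra_simps)
  then show ?thesis using U by (simp add: radical_def vec.subspace_def)
qed

text \<open>Since the functionals \<open>a(x, _)\<close> and \<open>b(x, _)\<close> are dependent on \<open>U\<close>, both vanish wherever a
suitable one of them does, so that one equation cuts out the common orthogonal space.\<close>

lemma dim_le_dim_perp:
  assumes U: "vec.subspace U" and cd: "c \<noteq> 0 \<or> d \<noteq> 0"
    and dep: "\<And>z. z \<in> U \<Longrightarrow> d * a x z = c * b x z"
  shows "vec.subspace {z \<in> U. a x z = 0 \<and> b x z = 0}"
    and "vec.dim U \<le> vec.dim {z \<in> U. a x z = 0 \<and> b x z = 0} + 1"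
proof -
  let ?P = "{z \<in> U. a x z = 0 \<and> b x z = 0}"
  consider "c \<noteq> 0" | "c = 0" "d \<noteq> 0" using cd by blast
  then have "?P = {z \<in> U. a x z = 0} \<or> ?P = {z \<in> U. b x z = 0}"
  proof cases
    case 1
    then have "b x z = 0" if "z \<in> U" "a x z = 0" for z using dep[OF that(1)] that(2) by simp
    then show ?thesis by blast
  next
    case 2
    then have "a x z = 0" if "z \<in> U" for z using dep[OF that] by simp
    then show ?thesis by auto
  qed
  moreover note dim_le_dim_hyperplane[OF U, of "a x", OF a_add a_scale]
    dim_le_dim_hyperplane[OF U, of "b x", OF b_add b_scale]
  ultimately show "vec.subspace ?P" "vec.dim U \<le> vec.dim ?P + 1"
    by auto
qed

text \<open>The hypothesis says that \<open>a + l b\<close> has rank at most \<open>r\<close> on \<open>U\<close> for all but finitely many \<open>l\<close>;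
allowing exceptions makes the hypothesis pass to smaller subspaces. The codimension of \<open>W0\<close>
records that \<open>b\<close> has rank at most \<open>r mod 2\<close> on \<open>W\<close>.

In the step, write \<open>U1\<close> for the vectors of \<open>U\<close> orthogonal to the isotropic eigenvector \<open>x\<close>. For
generic \<open>l\<close> the radical on \<open>U\<close> lies in \<open>U1\<close> and maps, modulo \<open>x\<close>, into the radical on the complement
\<open>U'\<close>. If \<open>U1\<close> is a proper subspace, \<open>x\<close> is not in that radical, so this map is injective and
the radical loses no dimension while the space loses two.\<close>

lemma ex_common_isotropic_subspace:
  assumes "vec.subspace U" and "finite {l. vec.dim (radical l U) + r < vec.dim U}"
  shows "\<exists>W W0. vec.subspace W \<and> vec.subspace W0 \<and> W \<subseteq> U \<and> W0 \<subseteq> W \<and>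
    vec.dim U \<le> vec.dim W + r div 2 \<and> vec.dim W \<le> vec.dim W0 + r mod 2 \<and>
    (\<forall>y\<in>W. \<forall>z\<in>W. a y z = 0) \<and> (\<forall>y\<in>W0. \<forall>z\<in>W. b y z = 0)"
  using assms
proof (induction "vec.dim U" arbitrary: U r rule: less_induct)
  case (less U r)
  note U = less.prems(1)
  let ?bad = "{l. vec.dim (radical l U) + r < vec.dim U}"
  consider (large) "2 \<le> vec.dim U" | (small) "vec.dim U \<le> 1" by linarith
  then show ?case
  proof cases
    case small
    obtain t where t: "U \<subseteq> vec.span {t}"
    proof -
      obtain B where B: "finite B" "U = vec.span B" "card B = vec.dim U"
        using vec.basis_subspace_exists[OF U] by metis
      then have "card B \<le> 1" using small by simp
      then obtain t where "B \<subseteq> {t}" using B(1)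
        by (metis card_le_Suc0_iff_eq One_nat_def subsetI singleton_iff all_not_in_conv empty_subsetI)
      then show thesis using that B(2) vec.span_mono by blast
    qed
    have a0: "a y z = 0" if "y \<in> U" "z \<in> U" for y z
    proof -
      have "y \<in> range (\<lambda>k. k *s t)" "z \<in> range (\<lambda>k. k *s t)"
        using that t unfolding vec.span_singleton by blast+
      then obtain j k where "y = j *s t" "z = k *s t" by blast
      then show ?thesis by (simp add: bilin)
    qed
    consider "r = 0" | "r = 1" | "2 \<le> r" by linarith
    then show ?thesis
    proof cases
      case 1
      have "infinite (UNIV - {0} :: complex set)" using infinite_UNIV_char_0 by simp
      then obtain l where l: "l \<noteq> 0" "l \<notin> ?bad"
        using less.prems(2) by (metis (no_types, lifting) DiffD2 finite_subset insertI1 subsetI)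
      then have rad: "radical l U = U"
        using 1 U by (intro vec.subspace_dim_equal subspace_radical) (auto simp: radical_def)
      have "b y z = 0" if "y \<in> U" "z \<in> U" for y z
      proof -
        have "z \<in> radical l U" using that rad by simp
        then have "a y z + l * b y z = 0" using that by (simp add: radical_def)
        then show ?thesis using a0[OF that] l(1) by simp
      qed
      then show ?thesis using a0 U 1 by (intro exI[of _ U]) auto
    next
      case 2
      show ?thesis
        by (rule exI[of _ U], rule exI[of _ "{0}"]) (use 2 a0 U small in \<open>auto simp: vec.subspace_0\<close>)
    next
      case 3
      then have "1 \<le> r div 2" by simp
      then show ?thesis
        using small U by (intro exI[of _ "{0}"]) (auto simp: vec.subspace_0)
    qed
  next
    case large
    obtain x c d where x: "x \<in> U" "x \<noteq> 0" "b x x = 0" and cd: "c \<noteq> 0 \<or> d \<noteq> 0"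
      and dep: "\<And>z. z \<in> U \<Longrightarrow> d * a x z = c * b x z"
      by (rule ex_isotropic_eigenvector[OF U large]) (rule that)
    define U1 where "U1 = {z \<in> U. a x z = 0 \<and> b x z = 0}"
    have U1: "vec.subspace U1" "vec.dim U \<le> vec.dim U1 + 1" "U1 \<subseteq> U"
      unfolding U1_def using dim_le_dim_perp[OF U cd dep] by auto
    have xU1: "x \<in> U1" using x by (simp add: U1_def)
    obtain U' where U': "vec.subspace U'" "U' \<subseteq> U1" "x \<notin> U'" "vec.dim U1 = vec.dim U' + 1"
      "\<And>y. y \<in> U1 \<Longrightarrow> \<exists>k. y - k *s x \<in> U'"
      by (rule complement_of_vector[OF U1(1) xU1 x(2)]) (rule that)
    \<comment> \<open>Away from the parameters \<open>\<plusminus>c / d\<close> (none if \<open>d = 0\<close>), being orthogonal to \<open>x\<close> on the left or on the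
      right for the form \<open>a + l b\<close> means lying in \<open>U1\<close>.\<close>
    let ?exc = "{l. c + l * d = 0} \<union> {l. c - l * d = 0}"
    have fin_exc: "finite ?exc"
    proof -
      have "l = - c / d \<or> l = c / d" if "l \<in> ?exc" for l
      proof -
        have "d \<noteq> 0" using that cd by auto
        then show ?thesis using that by (auto simp: field_simps add_eq_0_iff)
      qed
      then have "?exc \<subseteq> {- c / d, c / d}" by blast
      then show ?thesis by (rule finite_subset) simp
    qed
    have perp: "z \<in> U1" if "z \<in> U" "a x z + l * b x z = 0" "c + l * d \<noteq> 0" for z l
    proof -
      have "(c + l * d) * b x z = d * (a x z + l * b x z)"
        using dep[OF that(1)] by (simp add: algebra_simps)
      moreover have "(c + l * d) * a x z = c * (a x z + l * b x z)"
        using dep[OF that(1)] by (simp add: algebra_simps)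
      ultimately show ?thesis using that by (simp add: U1_def)
    qed
    have rad_U1: "radical l U \<subseteq> U1" if "l \<notin> ?exc" for l
      using that perp x(1) by (auto simp: radical_def)
    have rad_split: "radical l U \<subseteq> vec.span (insert x (radical l U'))" if l: "l \<notin> ?exc" for l
    proof
      fix y assume y: "y \<in> radical l U"
      then have "y \<in> U1" using rad_U1 l by blast
      then obtain k where k: "y - k *s x \<in> U'" using U'(5) by blast
      have "a z (y - k *s x) + l * b z (y - k *s x) = 0" if z: "z \<in> U'" for z
      proof -
        have "z \<in> U" "a x z = 0" "b x z = 0" using z U'(2) by (auto simp: U1_def)
        moreover have "a z x = 0" "b z x = 0" using calculation a_skew[of z x] b_sym[of z x] by auto
        ultimately show ?thesis using y by (simp add: radical_def diff_form bilin)
      qed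
      then have "y - k *s x \<in> radical l U'" using k by (simp add: radical_def)
      then show "y \<in> vec.span (insert x (radical l U'))"
        unfolding vec.span_breakdown_eq by (intro exI vec.span_base)
    qed
    have x_rad': "x \<notin> vec.span (radical l U')" for l
      using U'(3) vec.span_minimal[OF _ U'(1), of "radical l U'"] by (auto simp: radical_def)
    \<comment> \<open>If \<open>x\<close> lies in the radicals of both forms, removing it keeps the rank; otherwise the rank drops by 2.\<close>
    define r' where "r' = (if U1 = U then r else r - 2)"
    have key: "vec.dim U' \<le> vec.dim (radical l U') + r' \<and> (U1 \<noteq> U \<longrightarrow> 2 \<le> r)"
      if l: "l \<notin> ?bad \<union> ?exc" for l
    proof (cases "U1 = U")
      case True
      have "vec.dim (radical l U) \<le> vec.dim (radical l U') + 1"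
        using vec.subset_le_dim[OF rad_split, of l] l x_rad'[of l] by (simp add: vec.dim_insert)
      then show ?thesis using l U'(4) True by (auto simp: r'_def)
    next
      case False
      have x_rad: "x \<notin> radical l U"
      proof
        assume "x \<in> radical l U"
        then have "a x z + (- l) * b x z = 0" if "z \<in> U" for z
          using that a_skew[of z x] b_sym[of z x] by (auto simp: radical_def)
        then have "U \<subseteq> U1" using perp[of _ "-l"] l by auto
        then show False using False U1(3) by blast
      qed
      have sub: "insert x (radical l U) \<subseteq> vec.span (insert x (radical l U'))"
        using rad_split[of l] l vec.span_base by blast
      have x_span: "x \<notin> vec.span (radical l U)"
        using x_rad subspace_radical[OF U] by (simp add: vec.span_eq_iff[THEN iffD2])
      have "vec.dim (radical l U) \<le> vec.dim (radical l U')"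
        using vec.subset_le_dim[OF sub] x_rad'[of l] x_span by (simp add: vec.dim_insert)
      moreover have "vec.dim (radical l U) < vec.dim U1"
      proof -
        have "insert x (radical l U) \<subseteq> U1" using rad_U1[of l] l xU1 by blast
        then show ?thesis using vec.dim_subset[of "insert x (radical l U)" U1] x_span
          by (simp add: vec.dim_insert)
      qed
      moreover have "vec.dim U1 < vec.dim U"
        using False U1 U vec.subspace_dim_equal[of U1 U] by (meson linorder_not_le)
      ultimately show ?thesis using l U'(4) False by (auto simp: r'_def)
    qed
    have fin_bad: "finite (?bad \<union> ?exc)" using fin_exc less.prems(2) by simp
    obtain l0 where l0: "l0 \<notin> ?bad \<union> ?exc"
      using ex_new_if_finite[OF infinite_UNIV_char_0 fin_bad] ..
    have r2: "U1 \<noteq> U \<Longrightarrow> 2 \<le> r" using key[OF l0] by simp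
    have lt: "vec.dim U' < vec.dim U" using vec.dim_subset[OF U1(3)] U'(4) by simp
    have "{l. vec.dim (radical l U') + r' < vec.dim U'} \<subseteq> ?bad \<union> ?exc"
    proof
      fix l assume "l \<in> {l. vec.dim (radical l U') + r' < vec.dim U'}"
      then show "l \<in> ?bad \<union> ?exc" using key[of l] by (simp only: mem_Collect_eq) linarith
    qed
    then have fin': "finite {l. vec.dim (radical l U') + r' < vec.dim U'}"
      using fin_bad by (rule finite_subset)
    obtain W W0 where W: "vec.subspace W" "vec.subspace W0" "W \<subseteq> U'" "W0 \<subseteq> W"
      "vec.dim U' \<le> vec.dim W + r' div 2" "vec.dim W \<le> vec.dim W0 + r' mod 2"
      "\<forall>y\<in>W. \<forall>z\<in>W. a y z = 0" "\<forall>y\<in>W0. \<forall>z\<in>W. b y z = 0"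
      using less.hyps[OF lt U'(1) fin'] by blast
    let ?V = "vec.span (insert x W)" and ?R = "vec.span (insert x W0)"
    have V_dec: "\<exists>k. y - k *s x \<in> Z" if "y \<in> vec.span (insert x Z)" "vec.subspace Z" for y Z
      using that(1) unfolding vec.span_breakdown_eq vec.span_eq_iff[THEN iffD2, OF that(2)] .
    have dimV: "vec.dim ?V = vec.dim W + 1" "vec.dim ?R = vec.dim W0 + 1"
    proof -
      have "x \<notin> vec.span W" "x \<notin> vec.span W0"
        using W(3,4) U'(3)
        unfolding vec.span_eq_iff[THEN iffD2, OF W(1)] vec.span_eq_iff[THEN iffD2, OF W(2)] by blast+
      then show "vec.dim ?V = vec.dim W + 1" "vec.dim ?R = vec.dim W0 + 1"
        by (simp_all add: vec.dim_insert)
    qed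
    \<comment> \<open>On \<open>U1\<close> both forms are constant along the direction \<open>x\<close>.\<close>
    have shift: "a y z = a (y - j *s x) (z - k *s x)" "b y z = b (y - j *s x) (z - k *s x)"
      if "y - j *s x \<in> U1" "z - k *s x \<in> U1" for y z j k
    proof -
      define y' z' where "y' = y - j *s x" and "z' = z - k *s x"
      have yz: "y = y' + j *s x" "z = z' + k *s x" by (simp_all add: y'_def z'_def)
      have "a x y' = 0" "b x y' = 0" "a x z' = 0" "b x z' = 0"
        using that by (simp_all add: U1_def y'_def z'_def)
      then have "a y' x = 0" "b y' x = 0" "a x z' = 0" "b x z' = 0"
        using a_skew[of y' x] b_sym[of y' x] by simp_all
      then show "a y z = a (y - j *s x) (z - k *s x)" "b y z = b (y - j *s x) (z - k *s x)"
        unfolding y'_def[symmetric] z'_def[symmetric] unfolding yz by (simp_all add: bilin x(3))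
    qed
    have WU1: "W \<subseteq> U1" using W(3) U'(2) by blast
    have aV: "a y z = 0" if yz: "y \<in> ?V" "z \<in> ?V" for y z
    proof -
      obtain j k where "y - j *s x \<in> W" "z - k *s x \<in> W"
        using V_dec[OF yz(1) W(1)] V_dec[OF yz(2) W(1)] by blast
      then show ?thesis using shift(1)[of y j z k] WU1 W(7) by auto
    qed
    have bV: "b y z = 0" if yz: "y \<in> ?R" "z \<in> ?V" for y z
    proof -
      obtain j k where "y - j *s x \<in> W0" "z - k *s x \<in> W"
        using V_dec[OF yz(1) W(2)] V_dec[OF yz(2) W(1)] by blast
      then show ?thesis using shift(2)[of y j z k] WU1 W(4,8) by auto
    qed
    have "vec.dim U \<le> vec.dim ?V + r div 2"
    proof (cases "U1 = U")
      case True
      then show ?thesis using W(5) U'(4) dimV by (simp add: r'_def)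
    next
      case False
      then have "r div 2 = r' div 2 + 1" using r2 by (simp add: r'_def)
      then show ?thesis using W(5) U'(4) U1(2) dimV by simp
    qed
    moreover have "r' mod 2 = r mod 2"
      using r2 by (cases "U1 = U") (auto simp: r'_def mod2_eq_if)
    moreover have "?V \<subseteq> U"
      using WU1 U1(3) x(1) U by (intro vec.span_minimal) auto
    moreover have "?R \<subseteq> ?V" using W(4) by (intro vec.span_mono) blast
    ultimately show ?thesis
      using aV bV dimV W(6) by - (rule exI[of _ ?V], rule exI[of _ ?R], auto simp: vec.subspace_span)
  qed
qed

section \<open>Splitting the forms along a subspace\<close>

text \<open>If \<open>W\<close> is larger than \<open>W0\<close>, then \<open>W\<close> is \<open>W0\<close> plus the line of some \<open>t\<close>, and the form only sees
the coefficients of \<open>t\<close>: \<open>b(y, z) = k(y) k(z) b(t, t)\<close>. A square root of \<open>b(t, t)\<close> is absorbed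
into the functional.\<close>
lemma square_form_of_small_corank:
  assumes W: "vec.subspace W" "vec.subspace W0" "W0 \<subseteq> W" "vec.dim W \<le> vec.dim W0 + 1"
    and b0: "\<And>y z. y \<in> W0 \<Longrightarrow> z \<in> W \<Longrightarrow> b y z = 0"
  obtains h where "\<And>y z. y \<in> W \<Longrightarrow> z \<in> W \<Longrightarrow> b y z = h y * h z"
proof (cases "W \<subseteq> W0")
  case True
  then have "b y z = 0 * 0" if "y \<in> W" "z \<in> W" for y z using b0 that by auto
  then show thesis using that[of "\<lambda>_. 0"] by blast
next
  case False
  then obtain t where t: "t \<in> W" "t \<notin> W0" by blast
  have "vec.span (insert t W0) = W"
  proof (rule vec.subspace_dim_equal)
    show "vec.span (insert t W0) \<subseteq> W" using t W by (intro vec.span_minimal) auto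
    have "t \<notin> vec.span W0" using t(2) W(2) by (metis vec.span_eq_iff)
    then show "vec.dim W \<le> vec.dim (vec.span (insert t W0))"
      using W(4) by (simp add: vec.dim_insert)
  qed (use W in auto)
  then have "\<exists>k. y - k *s t \<in> W0" if "y \<in> W" for y
    using that W(2) by (metis vec.span_breakdown_eq vec.span_eq_iff)
  then obtain k where k: "\<And>y. y \<in> W \<Longrightarrow> y - k y *s t \<in> W0" by metis
  have step: "b y z = k y * b t z" if "y \<in> W" "z \<in> W" for y z
    using b0[OF k[OF that(1)] that(2)] by (simp add: diff_form bilin)
  have "b y z = (k y * csqrt (b t t)) * (k z * csqrt (b t t))" if "y \<in> W" "z \<in> W" for y z
  proof -
    have "b y z = k y * (k z * b t t)"
      using step[OF that] step[OF that(2) t(1)] b_sym[of t z] by simp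
    also have "\<dots> = k y * (k z * (csqrt (b t t))\<^sup>2)" by simp
    finally show ?thesis by (simp only: power2_eq_square mult.assoc mult.left_commute mult.commute)
  qed
  then show thesis by (rule that)
qed

lemma form_sum:
  "a (\<Sum>j\<in>J. f j) y = (\<Sum>j\<in>J. a (f j) y)" "b (\<Sum>j\<in>J. f j) y = (\<Sum>j\<in>J. b (f j) y)"
  "a y (\<Sum>j\<in>J. f j) = (\<Sum>j\<in>J. a y (f j))" "b y (\<Sum>j\<in>J. f j) = (\<Sum>j\<in>J. b y (f j))"
  by (induction J rule: infinite_finite_induct; simp add: bilin)+

text \<open>With \<open>p = 1 - q\<close>, bilinearity gives
\<open>f(x, y) = f(p x, p y) + f(q x, y) + f(x, q y) - f(q x, q y)\<close>. The last term is shared equally between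
the two middle ones; this makes the split symmetric in \<open>x\<close> and \<open>y\<close>, as the shape
\<open>v w(\<lambda>)\<^sup>T - w(-\<lambda>) v\<^sup>T\<close> requires.\<close>

lemma form_split:
  fixes \<delta> :: "'j \<Rightarrow> complex^'n \<Rightarrow> complex" and e :: "'j \<Rightarrow> complex^'n" and J :: "'j set"
  defines "q \<equiv> \<lambda>x. \<Sum>j\<in>J. \<delta> j x *s e j"
  shows "a x y = a (x - q x) (y - q y) + (\<Sum>j\<in>J. \<delta> j x * a (e j) (y - (1/2) *s q y))
      + (\<Sum>j\<in>J. a (x - (1/2) *s q x) (e j) * \<delta> j y)" (is ?A)
    and "b x y = b (x - q x) (y - q y) + (\<Sum>j\<in>J. \<delta> j x * b (e j) (y - (1/2) *s q y))
      + (\<Sum>j\<in>J. b (x - (1/2) *s q x) (e j) * \<delta> j y)" (is ?B)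
proof -
  have q: "(\<Sum>j\<in>J. \<delta> j x * a (e j) z) = a (q x) z" "(\<Sum>j\<in>J. \<delta> j x * b (e j) z) = b (q x) z"
    "(\<Sum>j\<in>J. a z (e j) * \<delta> j x) = a z (q x)" "(\<Sum>j\<in>J. b z (e j) * \<delta> j x) = b z (q x)" for x z
    by (simp_all add: q_def form_sum bilin mult.commute)
  show ?A ?B unfolding q by (simp_all add: diff_form bilin)
qed

end

text \<open>The sum is taken to be the projection onto a complement of \<open>W\<close> along \<open>W\<close>. The bound \<open>s\<close> may exceed the
dimension of the complement; the surplus coordinate functionals are zero.\<close>

lemma projection_along_subspace:
  fixes W :: "('a::field^'n) set"
  assumes W: "vec.subspace W" and dim: "CARD('n) \<le> vec.dim W + s"
  obtains \<delta> :: "nat \<Rightarrow> 'a^'n \<Rightarrow> 'a" and e where "\<And>x. x - (\<Sum>j=1..s. \<delta> j x *s e j) \<in> W"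
proof -
  obtain S where S: "finite S" "S \<subseteq> W" "vec.independent S" "vec.span S = W" "card S = vec.dim W"
    by (rule vec.basis_subspace_exists[OF W])
  obtain B where B: "S \<subseteq> B" "vec.independent B" "UNIV \<subseteq> vec.span B"
    by (rule vec.maximal_independent_subset_extend[OF subset_UNIV S(3)]) (rule that)
  have fB: "finite B" using B(2) by (rule vec.finiteI_independent)
  have "card B \<le> CARD('n)"
    using vec.independent_card_le_dim[OF subset_UNIV B(2)] by (simp add: vec_dim_card del: vec.dim_UNIV)
  then have C: "card (B - S) \<le> s" using dim B(1) S(1,5) fB by (simp add: card_Diff_subset)
  obtain e where e: "bij_betw e {1..card (B - S)} (B - S)"
    using ex_bij_betw_nat_finite_1[of "B - S"] fB by blast
  define \<delta> where "\<delta> j x = (if j \<le> card (B - S) then vec.representation B x (e j) else 0)" for j x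
  show thesis
  proof (rule that)
    fix x
    let ?c = "vec.representation B x"
    have "(\<Sum>j=1..s. \<delta> j x *s e j) = (\<Sum>j=1..card (B - S). ?c (e j) *s e j)"
      by (rule sum.mono_neutral_cong_right) (use C in \<open>auto simp: \<delta>_def\<close>)
    also have "\<dots> = (\<Sum>v\<in>B - S. ?c v *s v)"
      by (rule sum.reindex_bij_betw[OF e])
    finally have "x - (\<Sum>j=1..s. \<delta> j x *s e j) = (\<Sum>v\<in>B. ?c v *s v) - (\<Sum>v\<in>B - S. ?c v *s v)"
      using vec.sum_representation_eq[OF B(2) subsetD[OF B(3) UNIV_I] fB subset_refl, of x] by simp
    also have "\<dots> = (\<Sum>v\<in>S. ?c v *s v)"
      using sum.subset_diff[OF B(1) fB, of "\<lambda>v. ?c v *s v"] by simp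
    also have "\<dots> \<in> W" using S(2) by (intro vec.subspace_sum W vec.subspace_scale) auto
    finally show "x - (\<Sum>j=1..s. \<delta> j x *s e j) \<in> W" .
  qed
qed

section \<open>From the normal rank to kernels at points\<close>

lemma clear_denominators:
  fixes F :: "'a::idom fract set"
  assumes "finite F"
  obtains q where "q \<noteq> 0" "\<And>x. x \<in> F \<Longrightarrow> \<exists>p. to_fract q * x = to_fract p"
proof -
  have "\<exists>q. q \<noteq> 0 \<and> (\<forall>x\<in>F. \<exists>p. to_fract q * x = to_fract p)"
    using assms
  proof induction
    case empty
    show ?case by (rule exI[of _ 1]) simp
  next
    case (insert x F)
    then obtain q where q: "q \<noteq> 0" "\<And>y. y \<in> F \<Longrightarrow> \<exists>p. to_fract q * y = to_fract p" by blast
    obtain n d where x: "x = to_fract n / to_fract d" "d \<noteq> 0"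
      by (cases x) (auto simp: Fract_conv_to_fract)
    have "\<exists>p. to_fract (d * q) * y = to_fract p" if y: "y \<in> insert x F" for y
    proof (cases "y = x")
      case True
      then have "to_fract (d * q) * y = to_fract (q * n)" using x by simp
      then show ?thesis by blast
    next
      case False
      then obtain p where "to_fract q * y = to_fract p" using q(2) y by blast
      then have "to_fract (d * q) * y = to_fract (d * p)" by (simp add: mult.assoc)
      then show ?thesis by blast
    qed
    then show ?case using q(1) x(2) by (intro exI[of _ "d * q"]) simp
  qed
  then show thesis using that by blast
qed

lemma dim_le_dim_common_kernel:
  fixes h :: "'k \<Rightarrow> 'a::field^'n \<Rightarrow> 'a" and U :: "('a^'n) set"
  assumes U: "vec.subspace U" and K: "finite K"
    and add: "\<And>k x y. h k (x + y) = h k x + h k y" and scale: "\<And>k c x. h k (c *s x) = c * h k x"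
  shows "vec.subspace {z \<in> U. \<forall>k\<in>K. h k z = 0} \<and>
    vec.dim U \<le> vec.dim {z \<in> U. \<forall>k\<in>K. h k z = 0} + card K"
  using K
proof induction
  case empty
  then show ?case using U by simp
next
  case (insert k K)
  let ?Z = "{z \<in> U. \<forall>k\<in>K. h k z = 0}"
  have "{z \<in> U. \<forall>k\<in>insert k K. h k z = 0} = {z \<in> ?Z. h k z = 0}" by blast
  then show ?case
    using insert dim_le_dim_hyperplane[of ?Z "h k", OF _ add scale] by fastforce
qed

text \<open>Every row of \<open>E\<close> is a combination of \<open>normal_rank E\<close> of its rows over the field of fractions. Multiplied
by a common denominator \<open>q\<close> of the coefficients this is an identity of polynomials, and it can be
evaluated at \<open>l\<close>. Where \<open>q(l) \<noteq> 0\<close>, a vector killed by the chosen rows is killed by all of them,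
so that \<open>normal_rank E\<close> linear equations cut out a subspace of the kernel.\<close>

lemma dim_kernel_at_generic_point:
  fixes E :: "complex poly^'n^'m"
  shows "finite {l. vec.dim {y :: complex^'n. \<forall>i. (\<Sum>j\<in>UNIV. poly (E $ i $ j) l * y $ j) = 0}
    + normal_rank E < CARD('n)}" (is "finite {l. vec.dim (?ker l) + _ < _}")
proof -
  let ?F = "map_matrix to_fract E"
  obtain B where B: "B \<subseteq> rows ?F" "vec.independent B" "rows ?F \<subseteq> vec.span B" "card B = normal_rank E"
    using vec.basis_exists[of "rows ?F"] unfolding normal_rank_def row_rank_def_gen by metis
  have fB: "finite B" using B(2) by (rule vec.finiteI_independent)
  have "\<forall>v\<in>B. \<exists>i. v = row i ?F" using B(1) by (auto simp: rows_def)
  then obtain \<iota> where \<iota>: "\<And>v. v \<in> B \<Longrightarrow> v = row (\<iota> v) ?F" by metis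
  have "\<exists>c. row i ?F = (\<Sum>v\<in>B. c v *s v)" for i
    using B(3) unfolding vec.span_finite[OF fB] by (fastforce simp: rows_def)
  then have "\<exists>c. \<forall>i. row i ?F = (\<Sum>v\<in>B. c i v *s v)" by (intro choice allI)
  then obtain c where c: "\<And>i. row i ?F = (\<Sum>v\<in>B. c i v *s v)" by blast
  have "finite ((\<lambda>(i, v). c i v) ` (UNIV \<times> B))" using fB by simp
  then obtain q where q: "q \<noteq> 0"
    "\<And>x. x \<in> (\<lambda>(i, v). c i v) ` (UNIV \<times> B) \<Longrightarrow> \<exists>p. to_fract q * x = to_fract p"
    by (rule clear_denominators) (rule that)
  then have ex: "\<exists>p. to_fract q * c i v = to_fract p" if "v \<in> B" for i v
    using that by force
  have p: "to_fract q * c i v = to_fract (SOME p. to_fract q * c i v = to_fract p)"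
    if "v \<in> B" for i v
    by (rule someI_ex[OF ex[OF that]])
  define p where "p i v = (SOME p. to_fract q * c i v = to_fract p)" for i v
  note p = p[folded p_def]
  have sum_to_fract: "to_fract (\<Sum>v\<in>A. f v) = (\<Sum>v\<in>A. to_fract (f v))"
    for f :: "_ \<Rightarrow> complex poly" and A :: "(complex poly fract^'n) set"
    by (induction A rule: infinite_finite_induct) auto
  have E: "q * E $ i $ j = (\<Sum>v\<in>B. p i v * E $ \<iota> v $ j)" for i j
  proof -
    have "to_fract (q * E $ i $ j) = to_fract q * row i ?F $ j"
      by (simp add: row_def map_matrix_def)
    also have "\<dots> = (\<Sum>v\<in>B. (to_fract q * c i v) * v $ j)"
      by (simp add: c sum_distrib_left mult.assoc)
    also have "\<dots> = (\<Sum>v\<in>B. to_fract (p i v * E $ \<iota> v $ j))"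
    proof (rule sum.cong[OF refl])
      fix v assume v: "v \<in> B"
      have "v $ j = to_fract (E $ \<iota> v $ j)"
        by (subst \<iota>[OF v]) (simp add: row_def map_matrix_def)
      then show "(to_fract q * c i v) * v $ j = to_fract (p i v * E $ \<iota> v $ j)"
        by (simp add: p[OF v])
    qed
    finally show ?thesis by (simp only: sum_to_fract[symmetric] to_fract_eq_iff)
  qed
  have "CARD('n) \<le> vec.dim (?ker l) + normal_rank E" if l: "poly q l \<noteq> 0" for l
  proof -
    define h where "h v y = (\<Sum>j\<in>UNIV. poly (E $ \<iota> v $ j) l * y $ j)" for v and y :: "complex^'n"
    have dim_joint: "CARD('n) \<le> vec.dim {z \<in> UNIV. \<forall>v\<in>B. h v z = 0} + card B"
      using dim_le_dim_common_kernel[OF vec.subspace_UNIV fB, of h]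
      by (simp add: h_def sum.distrib algebra_simps sum_distrib_left vec_dim_card del: vec.dim_UNIV)
    have "{z \<in> UNIV. \<forall>v\<in>B. h v z = 0} \<subseteq> ?ker l"
    proof safe
      fix y i assume y: "\<forall>v\<in>B. h v y = 0"
      have "poly q l * (\<Sum>j\<in>UNIV. poly (E $ i $ j) l * y $ j)
          = (\<Sum>j\<in>UNIV. poly (q * E $ i $ j) l * y $ j)"
        by (simp add: sum_distrib_left mult.assoc)
      also have "\<dots> = (\<Sum>j\<in>UNIV. \<Sum>v\<in>B. poly (p i v) l * (poly (E $ \<iota> v $ j) l * y $ j))"
        by (simp add: E poly_sum sum_distrib_right mult.assoc)
      also have "\<dots> = (\<Sum>v\<in>B. poly (p i v) l * h v y)"
        by (subst sum.swap) (simp add: h_def sum_distrib_left)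
      also have "\<dots> = 0" using y by simp
      finally show "(\<Sum>j\<in>UNIV. poly (E $ i $ j) l * y $ j) = 0" using l by simp
    qed
    from vec.dim_subset[OF this] dim_joint show ?thesis using B(4) by linarith
  qed
  then have "{l. vec.dim (?ker l) + normal_rank E < CARD('n)} \<subseteq> {l. poly q l = 0}"
    by (auto simp: not_le[symmetric])
  then show ?thesis using poly_roots_finite[OF q(1)] by (rule finite_subset)
qed

section \<open>The decomposition of an odd pencil\<close>

lemma vec_degree_le:
  fixes v :: "complex poly^'n"
  assumes "\<And>i. degree (v $ i) \<le> k"
  shows "vec_degree v \<le> k"
  using assms by (auto simp: vec_degree_def)

lemma sum_linear_poly: "(\<Sum>j\<in>J. [:f j, g j:]) = [:\<Sum>j\<in>J. f j, \<Sum>j\<in>J. g j:]"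
  by (induction J rule: infinite_finite_induct) auto

theorem theorem7:
  fixes E :: "complex poly^'n^'n" and r s :: nat
  assumes "top_odd E"
    and "normal_rank E = r" and "r \<le> CARD('n)"
    and "s = r div 2"
  shows "\<exists>(u :: complex poly^'n) (v :: nat \<Rightarrow> complex poly^'n) (w :: nat \<Rightarrow> complex poly^'n).
           vec_degree u = 0 \<and>
           (\<forall>j\<in>{1..s}. vec_degree (v j) = 0 \<and> vec_degree (w j) \<le> 1) \<and>
           E = (if even r
                then (\<Sum>j=1..s. outer_prod (v j) (w j))
                       - (\<Sum>j=1..s. outer_prod (vec_reflect (w j)) (v j))
                else outer_prod ([:0, 1:] *s u) u
                       + (\<Sum>j=1..s. outer_prod (v j) (w j))
                       - (\<Sum>j=1..s. outer_prod (vec_reflect (w j)) (v j)))"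
proof -
  obtain A B where E: "E = pencil A B" and A: "transpose A = - A" and B: "transpose B = B"
    using assms(1) unfolding top_odd_def by blast
  have A_ij: "A $ j $ i = - A $ i $ j" and B_ij: "B $ j $ i = B $ i $ j" for i j
    using arg_cong[OF A, of "\<lambda>M. M $ i $ j"] arg_cong[OF B, of "\<lambda>M. M $ i $ j"]
    by (simp_all add: transpose_def)
  define a b :: "complex^'n \<Rightarrow> complex^'n \<Rightarrow> complex"
    where "a x y = (\<Sum>i\<in>UNIV. \<Sum>j\<in>UNIV. A $ i $ j * (x $ i * y $ j))"
      and "b x y = (\<Sum>i\<in>UNIV. \<Sum>j\<in>UNIV. B $ i $ j * (x $ i * y $ j))" for x y
  interpret odd_forms a b
  proof
    fix x y z and c :: complex
    show "a x (y + z) = a x y + a x z" "a x (c *s y) = c * a x y"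
      "b x (y + z) = b x y + b x z" "b x (c *s y) = c * b x y"
      by (simp_all add: a_def b_def sum.distrib sum_distrib_left algebra_simps)
    show "a x y = - a y x"
      unfolding a_def sum_negf[symmetric]
      by (subst sum.swap, intro sum.cong refl, subst A_ij) (simp add: mult.commute)
    show "b x y = b y x"
      unfolding b_def
      by (subst sum.swap, intro sum.cong refl, subst B_ij) (simp add: mult.commute)
  qed
  have "M $ k $ l * (axis i 1 $ k * axis j 1 $ l) = (if l = j then if k = i then M $ k $ l else 0 else 0)"
    for M :: "complex^'n^'n" and i j k l by (simp add: axis_def)
  then have ab_axis: "a (axis i 1) (axis j 1) = A $ i $ j" "b (axis i 1) (axis j 1) = B $ i $ j" for i j
    by (simp_all add: a_def b_def)
  have "{l. vec.dim (radical l UNIV) + r < vec.dim (UNIV :: (complex^'n) set)} \<subseteq>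
    {l. vec.dim {y :: complex^'n. \<forall>i. (\<Sum>j\<in>UNIV. poly (E $ i $ j) l * y $ j) = 0}
      + normal_rank E < CARD('n)}"
  proof safe
    fix l assume l: "vec.dim (radical l UNIV) + r < vec.dim (UNIV :: (complex^'n) set)"
    have "{y :: complex^'n. \<forall>i. (\<Sum>j\<in>UNIV. poly (E $ i $ j) l * y $ j) = 0} \<subseteq> radical l UNIV"
    proof safe
      fix y :: "complex^'n" assume y: "\<forall>i. (\<Sum>j\<in>UNIV. poly (E $ i $ j) l * y $ j) = 0"
      have "a z y + l * b z y = (\<Sum>i\<in>UNIV. z $ i * (\<Sum>j\<in>UNIV. poly (E $ i $ j) l * y $ j))" for z
        unfolding a_def b_def sum_distrib_left sum.distrib[symmetric]
        by (intro sum.cong refl) (simp add: E pencil_def algebra_simps)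
      then show "y \<in> radical l UNIV" using y by (simp add: radical_def)
    qed
    from vec.dim_subset[OF this] l
    show "vec.dim {y :: complex^'n. \<forall>i. (\<Sum>j\<in>UNIV. poly (E $ i $ j) l * y $ j) = 0}
      + normal_rank E < CARD('n)"
      using assms(2) by (simp add: vec_dim_card del: vec.dim_UNIV)
  qed
  then have fin: "finite {l. vec.dim (radical l UNIV) + r < vec.dim (UNIV :: (complex^'n) set)}"
    using dim_kernel_at_generic_point by (rule finite_subset)
  obtain W W0 where W: "vec.subspace W" "vec.subspace W0" "W0 \<subseteq> W"
      "vec.dim (UNIV :: (complex^'n) set) \<le> vec.dim W + r div 2" "vec.dim W \<le> vec.dim W0 + r mod 2"
    and aW: "\<And>y z. y \<in> W \<Longrightarrow> z \<in> W \<Longrightarrow> a y z = 0"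
    and bW: "\<And>y z. y \<in> W0 \<Longrightarrow> z \<in> W \<Longrightarrow> b y z = 0"
    using ex_common_isotropic_subspace[OF vec.subspace_UNIV fin] by blast
  have corank: "vec.dim W \<le> vec.dim W0 + 1" using W(5) by (simp add: mod2_eq_if split: if_splits)
  obtain h where h: "\<And>y z. y \<in> W \<Longrightarrow> z \<in> W \<Longrightarrow> b y z = h y * h z"
    by (rule square_form_of_small_corank[OF W(1-3) corank bW]) (assumption | rule that)+
  have bW_even: "b y z = 0" if "even r" "y \<in> W" "z \<in> W" for y z
  proof -
    have "W0 = W" by (rule vec.subspace_dim_equal) (use W that(1) in auto)
    then show ?thesis using bW that by simp
  qed
  \<comment> \<open>\<open>q\<close> projects along \<open>W\<close>; the \<open>v j\<close> are its coordinate functionals, read off on the standard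
    basis, and \<open>w j\<close> is the pencil applied to the basis vector \<open>e j\<close> and \<open>g = 1 - q / 2\<close>.\<close>
  obtain \<delta> e where \<delta>: "\<And>x. x - (\<Sum>j=1..s. \<delta> j x *s e j) \<in> W"
    using projection_along_subspace[OF W(1), of s] W(4) assms(4)
    by (auto simp: vec_dim_card simp del: vec.dim_UNIV)
  define q where "q x = (\<Sum>j=1..s. \<delta> j x *s e j)" for x
  define g where "g x = x - (1/2) *s q x" for x
  have qW: "x - q x \<in> W" for x using \<delta> by (simp add: q_def)
  define v w :: "nat \<Rightarrow> complex poly^'n"
    where "v j = (\<chi> i. [:\<delta> j (axis i 1):])"
      and "w j = (\<chi> i. [:a (e j) (g (axis i 1)), b (e j) (g (axis i 1)):])" for j
  define u :: "complex poly^'n" where "u = (\<chi> i. [:h (axis i 1 - q (axis i 1)):])"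
  have entry: "[:A $ i $ j, B $ i $ j:] = [:0, b (axis i 1 - q (axis i 1)) (axis j 1 - q (axis j 1)):]
      + (\<Sum>k=1..s. v k $ i * w k $ j) - (\<Sum>k=1..s. vec_reflect (w k) $ i * v k $ j)" for i j
  proof -
    have v_w: "(\<Sum>k=1..s. v k $ i * w k $ j) =
        [:\<Sum>k=1..s. \<delta> k (axis i 1) * a (e k) (g (axis j 1)),
          \<Sum>k=1..s. \<delta> k (axis i 1) * b (e k) (g (axis j 1)):]"
      by (simp add: v_def w_def sum_linear_poly mult.commute)
    have "vec_reflect (w k) $ i * v k $ j =
        [:- (a (g (axis i 1)) (e k) * \<delta> k (axis j 1)), - (b (g (axis i 1)) (e k) * \<delta> k (axis j 1)):]" for k
      using a_skew[of "e k" "g (axis i 1)"] b_sym[of "e k" "g (axis i 1)"]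
      by (simp add: v_def w_def vec_reflect_def pcompose_pCons)
    then have w_v: "(\<Sum>k=1..s. vec_reflect (w k) $ i * v k $ j) =
        [:- (\<Sum>k=1..s. a (g (axis i 1)) (e k) * \<delta> k (axis j 1)),
          - (\<Sum>k=1..s. b (g (axis i 1)) (e k) * \<delta> k (axis j 1)):]"
      by (simp add: sum_linear_poly sum_negf)
    have "A $ i $ j = (\<Sum>k=1..s. \<delta> k (axis i 1) * a (e k) (g (axis j 1)))
        + (\<Sum>k=1..s. a (g (axis i 1)) (e k) * \<delta> k (axis j 1))"
      using form_split(1)[of "axis i 1" "axis j 1" \<delta> e "{1..s}"] aW[OF qW qW]
      unfolding q_def[symmetric] g_def[symmetric] ab_axis by simp
    moreover have "B $ i $ j = b (axis i 1 - q (axis i 1)) (axis j 1 - q (axis j 1))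
        + (\<Sum>k=1..s. \<delta> k (axis i 1) * b (e k) (g (axis j 1)))
        + (\<Sum>k=1..s. b (g (axis i 1)) (e k) * \<delta> k (axis j 1))"
      using form_split(2)[of "axis i 1" "axis j 1" \<delta> e "{1..s}"]
      unfolding q_def[symmetric] g_def[symmetric] ab_axis .
    ultimately show ?thesis unfolding v_w w_v by simp
  qed
  have "E = (if even r
                then (\<Sum>j=1..s. outer_prod (v j) (w j))
                       - (\<Sum>j=1..s. outer_prod (vec_reflect (w j)) (v j))
                else outer_prod ([:0, 1:] *s u) u
                       + (\<Sum>j=1..s. outer_prod (v j) (w j))
                       - (\<Sum>j=1..s. outer_prod (vec_reflect (w j)) (v j)))"
  proof (cases "even r")
    case True
    then show ?thesis
      by (simp add: vec_eq_iff E pencil_def outer_prod_def entry bW_even[OF True qW qW])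
  next
    case False
    then show ?thesis
      by (simp add: vec_eq_iff E pencil_def outer_prod_def entry h[OF qW qW] u_def)
  qed
  moreover have "vec_degree u \<le> 0" "vec_degree (v j) \<le> 0" "vec_degree (w j) \<le> 1" for j
    by (rule vec_degree_le; simp add: u_def v_def w_def)+
  ultimately show ?thesis by (intro exI[of _ u] exI[of _ v] exI[of _ w]) simp
qed

end
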